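(* Let $M_R,M_T\ge1$ be integers and $\rho_1,\rho_2$ real with $|\rho_1|<1$, $|\rho_2|<1$. Let $z_0$, $z_{i1}$ ($2\le i\le M_R$), $z_{1j}$ ($2\le j\le M_T$), $z_{ij}$ ($2\le i\le M_R$, $2\le j\le M_T$) be independent circularly symmetric complex Gaussian random variables with mean $0$ and variance $1$ (i.e. $\mathbb{E}|z|^2=1$), and for $2\le i\le M_R$, $2\le j\le M_T$ put $$h_{11}=z_0,\quad h_{i1}=\sqrt{1-\rho_1^2}\,z_{i1}+\rho_1z_0,\quad h_{1j}=\sqrt{1-\rho_2^2}\,z_{1j}+\rho_2z_0,\quad h_{ij}=\sqrt{1-\rho_1^2\rho_2^2}\,z_{ij}+\rho_1\rho_2z_0 .$$ Let $|h_{\rm FAS}|=\max_{1\le i\le M_R,\,1\le j\le M_T}|h_{ij}|$ and $P_{\rm out}(\gamma_{th})=\Pr(|h_{\rm FAS}|^2<\gamma_{th})$. Then for every $\gamma_{th}>0$, $$P_{\rm out}(\gamma_{th})\le\left(1-e^{-\gamma_{th}}\right)\left(1-e^{-\frac{\gamma_{th}}{1-\rho_1^2}}\right)^{M_R-1}\left(1-e^{-\frac{\gamma_{th}}{1-\rho_2^2}}\right)^{M_T-1}\left(1-e^{-\frac{\gamma_{th}}{1-\rho_1^2\rho_2^2}}\right)^{(M_R-1)(M_T-1)}.$$ *)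

theory Defs
  imports "HOL-Probability.Probability"
begin

(* CN(0, v), the circularly symmetric complex normal law with mean 0 and E|Z|^2 = v > 0: the real
   and imaginary parts are independent N(0, v/2); normal_density takes the standard deviation. *)
definition circ_complex_normal :: "'a measure \<Rightarrow> real \<Rightarrow> ('a \<Rightarrow> complex) \<Rightarrow> bool" where
  "circ_complex_normal M v Z \<longleftrightarrow>
     prob_space.indep_var M borel (\<lambda>\<omega>. Re (Z \<omega>)) borel (\<lambda>\<omega>. Im (Z \<omega>)) \<and>
     distributed M lborel (\<lambda>\<omega>. Re (Z \<omega>)) (normal_density 0 (sqrt (v / 2))) \<and>
     distributed M lborel (\<lambda>\<omega>. Im (Z \<omega>)) (normal_density 0 (sqrt (v / 2)))"

lemma circ_complex_normal_mean_variance: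
  assumes "prob_space M" and "v > 0" and Z: "circ_complex_normal M v Z"
  shows "integrable M Z"
    and "integral\<^sup>L M Z = 0"
    and "integrable M (\<lambda>\<omega>. (cmod (Z \<omega>))\<^sup>2)"
    and "integral\<^sup>L M (\<lambda>\<omega>. (cmod (Z \<omega>))\<^sup>2) = v"
proof -
  interpret prob_space M by fact
  have s: "sqrt (v / 2) > 0" using \<open>v > 0\<close> by simp
  have part: "integrable M X \<and> expectation X = 0 \<and>
      integrable M (\<lambda>\<omega>. (X \<omega>)\<^sup>2) \<and> expectation (\<lambda>\<omega>. (X \<omega>)\<^sup>2) = v / 2"
    if X: "distributed M lborel X (normal_density 0 (sqrt (v / 2)))" for X
  proof -
    have i1: "integrable M X"
      using distributed_integrable[OF X, of "\<lambda>x. x"] integrable_normal_moment[OF s, of 0 1]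
      by simp
    have i2: "integrable M (\<lambda>\<omega>. (X \<omega>)\<^sup>2)"
      using distributed_integrable[OF X, of "\<lambda>x. x\<^sup>2"] integrable_normal_moment[OF s, of 0 2]
      by simp
    have e1: "expectation X = 0"
      by (rule normal_distributed_expectation[OF s X])
    have "variance X = v / 2"
      using normal_distributed_variance[OF s X] \<open>v > 0\<close> by simp
    then show ?thesis using i1 i2 e1 by simp
  qed
  have Re: "distributed M lborel (\<lambda>\<omega>. Re (Z \<omega>)) (normal_density 0 (sqrt (v / 2)))"
    and Im: "distributed M lborel (\<lambda>\<omega>. Im (Z \<omega>)) (normal_density 0 (sqrt (v / 2)))"
    using Z by (auto simp: circ_complex_normal_def)
  note R = part[OF Re] and I = part[OF Im]
  show "integrable M Z"
  proof -
    have "integrable M (\<lambda>\<omega>. complex_of_real (Re (Z \<omega>)) + \<i> * complex_of_real (Im (Z \<omega>)))"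
      using R I by (intro Bochner_Integration.integrable_add integrable_mult_right) auto
    then show ?thesis by (simp flip: complex_eq)
  qed
  then show "integral\<^sup>L M Z = 0"
    using R I by (simp add: complex_eq_iff flip: integral_Re integral_Im)
  show "integrable M (\<lambda>\<omega>. (cmod (Z \<omega>))\<^sup>2)"
    using R I by (simp add: cmod_power2)
  show "integral\<^sup>L M (\<lambda>\<omega>. (cmod (Z \<omega>))\<^sup>2) = v"
    using R I by (simp add: cmod_power2)
qed

(* The coefficient h_ij, for i, j \<ge> 1; z 1 1 plays the role of z_0, the variable shared by all ports. *)
definition channel :: "real \<Rightarrow> real \<Rightarrow> (nat \<Rightarrow> nat \<Rightarrow> 'a \<Rightarrow> complex) \<Rightarrow> nat \<Rightarrow> nat \<Rightarrow> 'a \<Rightarrow> complex" where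
  "channel \<rho>1 \<rho>2 z i j \<omega> =
     (if i = 1 \<and> j = 1 then z 1 1 \<omega>
      else if j = 1 then of_real (sqrt (1 - \<rho>1\<^sup>2)) * z i 1 \<omega> + of_real \<rho>1 * z 1 1 \<omega>
      else if i = 1 then of_real (sqrt (1 - \<rho>2\<^sup>2)) * z 1 j \<omega> + of_real \<rho>2 * z 1 1 \<omega>
      else of_real (sqrt (1 - \<rho>1\<^sup>2 * \<rho>2\<^sup>2)) * z i j \<omega> + of_real (\<rho>1 * \<rho>2) * z 1 1 \<omega>)"

definition fas_amplitude ::
    "nat \<Rightarrow> nat \<Rightarrow> (nat \<Rightarrow> nat \<Rightarrow> 'a \<Rightarrow> complex) \<Rightarrow> 'a \<Rightarrow> real" where
  "fas_amplitude MR MT h \<omega> = Max {cmod (h i j \<omega>) | i j. i \<in> {1..MR} \<and> j \<in> {1..MT}}"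

definition outage_prob ::
    "'a measure \<Rightarrow> nat \<Rightarrow> nat \<Rightarrow> (nat \<Rightarrow> nat \<Rightarrow> 'a \<Rightarrow> complex) \<Rightarrow> real \<Rightarrow> real" where
  "outage_prob M MR MT h \<gamma> = measure M {\<omega> \<in> space M. (fas_amplitude MR MT h \<omega>)\<^sup>2 < \<gamma>}"

end

(* Condition on the shared variable z_0: the remaining coefficients are then independent, and each is
   a centred Gaussian shifted by a constant. A ball has the same volume as its translate, so a density
   that decreases with the norm gives the ball centred at the origin the larger mass (Anderson's
   inequality for discs). Hence every shift may be dropped, and the squared modulus of a centred
   circularly symmetric Gaussian is exponentially distributed. *)

theory Submission
  imports Defs "HOL-Real_Asymp.Real_Asymp"
begin

section \<open>Radially decreasing densities: shifted balls and the Gaussian tail in the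
  plane\<close>

text \<open>Exchange argument: the balls share \<open>A \<inter> B\<close>, and the remainders
  \<open>A - B\<close> and \<open>B - A\<close> have equal volume. Outside the centred ball
  \<open>f\<close> is at most its value on the sphere of radius \<open>r\<close>, inside it is at
  least that value, so trading \<open>A - B\<close> for \<open>B - A\<close> cannot lower the
  integral.\<close>

lemma nn_integral_ball_shift_le:
  fixes f :: "'a::euclidean_space \<Rightarrow> ennreal" and c :: 'a
  assumes [measurable]: "f \<in> borel_measurable borel"
    and decr: "\<And>x y. norm x \<le> norm y \<Longrightarrow> f y \<le> f x" and r: "r \<ge> 0"
  shows "(\<integral>\<^sup>+x\<in>ball c r. f x \<partial>lborel) \<le> (\<integral>\<^sup>+x\<in>ball 0 r. f x \<partial>lborel)"
proof -
  \<comment> \<open>A point of the sphere: \<open>f e\<close> is the constant against which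
    \<open>f\<close> is compared on both remainders.\<close>
  obtain e :: 'a where e: "norm e = r"
    using vector_choose_size r by blast
  define A B where "A = ball c r" and "B = ball (0::'a) r"
  have [measurable]: "A \<in> sets borel" "B \<in> sets borel"
    by (simp_all add: A_def B_def)
  have eq: "emeasure lborel (A - B) = emeasure lborel (B - A)"
  proof -
    \<comment> \<open>Finiteness of the overlap allows its volume to be subtracted in
      \<open>ennreal\<close>.\<close>
    have fin: "emeasure lborel (A \<inter> B) \<noteq> \<infinity>"
      using emeasure_mono[of "A \<inter> B" A lborel] emeasure_ball[OF r, of c]
      by (auto simp: A_def top_unique)
    have "emeasure lborel (A - B) = emeasure lborel A - emeasure lborel (A \<inter> B)"
      using emeasure_Diff[OF fin, of A] by (simp add: Diff_Int)
    also have "emeasure lborel A = emeasure lborel B"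
      using r by (simp add: A_def B_def emeasure_ball)
    also have "emeasure lborel B - emeasure lborel (A \<inter> B) = emeasure lborel (B - A)"
      using emeasure_Diff[OF fin, of B] by (simp add: Diff_Int)
    finally show ?thesis .
  qed
  have split: "(\<integral>\<^sup>+x\<in>S. f x \<partial>lborel)
      = (\<integral>\<^sup>+x\<in>A \<inter> B. f x \<partial>lborel) + (\<integral>\<^sup>+x\<in>S - (A \<inter> B). f x \<partial>lborel)"
    if [measurable]: "S \<in> sets borel" and "A \<inter> B \<subseteq> S" for S
    using that(2) by (subst nn_integral_add[symmetric])
      (auto intro!: nn_integral_cong simp: indicator_def)
  have "(\<integral>\<^sup>+x\<in>A - B. f x \<partial>lborel) \<le> (\<integral>\<^sup>+x\<in>A - B. f e \<partial>lborel)"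
    using e by (intro nn_integral_mono) (auto simp: B_def indicator_def intro!: decr)
  also have "\<dots> = (\<integral>\<^sup>+x\<in>B - A. f e \<partial>lborel)"
    by (simp add: nn_integral_cmult_indicator eq)
  also have "\<dots> \<le> (\<integral>\<^sup>+x\<in>B - A. f x \<partial>lborel)"
    using e by (intro nn_integral_mono) (auto simp: B_def indicator_def intro!: decr)
  finally have "(\<integral>\<^sup>+x\<in>A. f x \<partial>lborel) \<le> (\<integral>\<^sup>+x\<in>B. f x \<partial>lborel)"
    using split[of A] split[of B] by (simp add: Diff_Int add_mono)
  then show ?thesis by (simp add: A_def B_def)
qed

(* Layer-cake argument: exp (- |p|^2 / v) is the integral of exp (- s) over s \<ge> |p|^2 / v, so swapping
   the integrals leaves only areas of annuli. *)
lemma nn_integral_radial_exp_tail: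
  fixes v r :: real
  assumes v: "v > 0" and r: "r \<ge> 0"
  shows "(\<integral>\<^sup>+p\<in>- ball 0 r. ennreal (exp (- (norm p)\<^sup>2 / v) / (pi * v)) \<partial>(lborel :: (real \<times> real) measure))
    = ennreal (exp (- r\<^sup>2 / v))"
proof -
  define L where "L = (lborel :: (real \<times> real) measure)"
  interpret L: sigma_finite_measure L unfolding L_def by (rule sigma_finite_lborel)
  interpret LR: pair_sigma_finite L "lborel :: real measure" ..
  have [measurable_cong, simp]: "sets L = sets borel" by (simp add: L_def)
  \<comment> \<open>For fixed \<open>p\<close>, integrating over \<open>s\<close> recovers the
    density off the disc; for fixed \<open>s\<close>, \<open>g\<close> is constant on an annulus and
    zero elsewhere.\<close>
  define g where "g p s = ennreal (exp (- s)) * indicator {(norm p)\<^sup>2 / v..} s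
      * (indicator (- ball 0 r) p * ennreal (1 / (pi * v)))" for p :: "real \<times> real" and s
  \<comment> \<open>Limits at infinity of the antiderivatives of \<open>exp (- s)\<close> and
    \<open>(s - a) * exp (- s)\<close>; the \<open>+ 1\<close> comes from integration by
    parts.\<close>
  have lim0: "((\<lambda>s. - exp (- s)) \<longlongrightarrow> (0::real)) at_top"
    by real_asymp
  have lim1: "((\<lambda>s. - ((s - a + 1) * exp (- s))) \<longlongrightarrow> (0::real)) at_top" for a :: real
    by real_asymp
  have exp_tail: "(\<integral>\<^sup>+s. ennreal (exp (- s)) * indicator {a..} s \<partial>lborel) = ennreal (exp (- a))"
    for a :: real
  proof -
    have "((\<lambda>s. - exp (- s)) has_real_derivative exp (- x)) (at x)" for x :: real
      by (auto intro!: derivative_eq_intros)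
    from nn_integral_FTC_atLeast[OF _ this _ lim0, of a] show ?thesis by simp
  qed
  have annulus: "emeasure L (cball 0 (sqrt (v * s)) - ball 0 r) = ennreal (pi * (v * s - r\<^sup>2))"
    if s: "r\<^sup>2 / v \<le> s" for s
  proof -
    have s': "r\<^sup>2 \<le> v * s" using s v by (simp add: field_simps)
    then have "r \<le> sqrt (v * s)" by (rule real_le_rsqrt)
    then have "ball 0 r \<subseteq> (cball 0 (sqrt (v * s)) :: (real \<times> real) set)" by auto
    moreover have vs: "0 \<le> v * s" using s' by (meson order.trans zero_le_power2)
    ultimately have "emeasure L (cball 0 (sqrt (v * s)) - ball 0 r)
        = ennreal (pi * (v * s)) - ennreal (pi * r\<^sup>2)"
      using r unfolding L_def
      by (subst emeasure_Diff) (simp_all add: emeasure_ball emeasure_cball unit_ball_vol_2 power2_eq_square)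
    also have "\<dots> = ennreal (pi * (v * s - r\<^sup>2))"
      by (subst ennreal_minus) (simp_all add: algebra_simps)
    finally show ?thesis .
  qed
  have inner: "(\<integral>\<^sup>+p. g p s \<partial>L)
      = ennreal ((s - r\<^sup>2 / v) * exp (- s)) * indicator {r\<^sup>2 / v..} s" for s
  proof -
    \<comment> \<open>\<open>sqrt\<close> is strictly increasing on all reals, with
      \<open>sqrt (- x) = - sqrt x\<close>, so the equivalence also covers negative
      \<open>s\<close>, where both sides are false.\<close>
    have "s * v \<ge> (norm p)\<^sup>2 \<longleftrightarrow> norm p \<le> sqrt (v * s)" for p :: "real \<times> real"
      by (metis abs_norm_cancel mult.commute real_sqrt_le_iff real_sqrt_abs)
    then have ind: "g p s = ennreal (exp (- s) / (pi * v)) * indicator (cball 0 (sqrt (v * s)) - ball 0 r) p" for p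
      using v by (auto simp: g_def indicator_def ennreal_mult'[symmetric] field_simps)
    show ?thesis
    proof (cases "r\<^sup>2 / v \<le> s")
      case True
      have "(\<integral>\<^sup>+p. g p s \<partial>L) = ennreal (exp (- s) / (pi * v)) * ennreal (pi * (v * s - r\<^sup>2))"
        using True by (simp add: ind nn_integral_cmult_indicator annulus)
      also have "\<dots> = ennreal ((s - r\<^sup>2 / v) * exp (- s))"
        using v by (simp add: ennreal_mult'[symmetric]) (simp add: field_simps)
      finally show ?thesis using True by simp
    next
      case False
      \<comment> \<open>The outer radius is now below \<open>r\<close>, and negative if
        \<open>s\<close> is, so the annulus is empty.\<close>
      then have "v * s < r\<^sup>2" using v by (simp add: field_simps)
      then have "sqrt (v * s) < r" using r real_less_lsqrt
        by (metis abs_of_nonneg real_sqrt_abs real_sqrt_less_iff)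
      then have empty: "cball 0 (sqrt (v * s)) - ball 0 r = ({} :: (real \<times> real) set)" by auto
      show ?thesis using False unfolding ind empty by simp
    qed
  qed
  have "(\<integral>\<^sup>+p\<in>- ball 0 r. ennreal (exp (- (norm p)\<^sup>2 / v) / (pi * v)) \<partial>L)
      = (\<integral>\<^sup>+p. \<integral>\<^sup>+s. g p s \<partial>lborel \<partial>L)"
  proof (rule nn_integral_cong)
    fix p :: "real \<times> real"
    have "(\<integral>\<^sup>+s. g p s \<partial>lborel)
        = ennreal (exp (- ((norm p)\<^sup>2 / v))) * (indicator (- ball 0 r) p * ennreal (1 / (pi * v)))"
      unfolding g_def by (subst nn_integral_multc) (auto simp: exp_tail)
    then show "ennreal (exp (- (norm p)\<^sup>2 / v) / (pi * v)) * indicator (- ball 0 r) p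
        = (\<integral>\<^sup>+s. g p s \<partial>lborel)"
      using v by (simp add: ennreal_mult'[symmetric] split: split_indicator)
  qed
  also have "\<dots> = (\<integral>\<^sup>+s. \<integral>\<^sup>+p. g p s \<partial>L \<partial>lborel)"
    unfolding g_def indicator_def by (rule LR.Fubini'[symmetric]) (simp add: case_prod_unfold, measurable)
  also have "\<dots> = ennreal (exp (- r\<^sup>2 / v))"
    unfolding inner
  proof -
    \<comment> \<open>At the lower endpoint \<open>r\<^sup>2 / v\<close> this antiderivative equals
      minus the claimed value, and it vanishes at infinity.\<close>
    have "((\<lambda>s. - ((s - r\<^sup>2 / v + 1) * exp (- s))) has_real_derivative (x - r\<^sup>2 / v) * exp (- x)) (at x)" for x
      using v by (auto intro!: derivative_eq_intros simp: algebra_simps)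
    from nn_integral_FTC_atLeast[OF _ this _ lim1, of "r\<^sup>2 / v"]
    show "(\<integral>\<^sup>+s. ennreal ((s - r\<^sup>2 / v) * exp (- s)) * indicator {r\<^sup>2 / v..} s \<partial>lborel)
      = ennreal (exp (- r\<^sup>2 / v))" by simp
  qed
  finally show ?thesis by (simp add: L_def)
qed

section \<open>Disc probabilities of the circularly symmetric complex Gaussian\<close>

text \<open>Each coordinate has variance \<open>v / 2\<close>, so the exponents add up to a multiple
  of the squared norm and the two factors 1/sqrt(pi v) multiply to 1/(pi v). This exhibits the
  density as radial, as the two preceding lemmas require.\<close>

lemma (in prob_space) circ_complex_normal_joint_density:
  assumes v: "v > 0" and Z: "circ_complex_normal M v Z"
  shows "distributed M lborel (\<lambda>\<omega>. (Re (Z \<omega>), Im (Z \<omega>)))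
    (\<lambda>p. ennreal (exp (- (norm p)\<^sup>2 / v) / (pi * v)))"
proof -
  \<comment> \<open>\<open>borel\<close> and \<open>lborel\<close> have the same measurable sets;
    the change makes Lebesgue measure the reference measure of the joint density.\<close>
  have "indep_var lborel (\<lambda>\<omega>. Re (Z \<omega>)) lborel (\<lambda>\<omega>. Im (Z \<omega>))"
    using Z unfolding circ_complex_normal_def indep_var_distribution_eq
    by (auto cong: distr_cong)
  then have "distributed M (lborel \<Otimes>\<^sub>M lborel) (\<lambda>\<omega>. (Re (Z \<omega>), Im (Z \<omega>)))
    (\<lambda>(x, y). ennreal (normal_density 0 (sqrt (v / 2)) x) * ennreal (normal_density 0 (sqrt (v / 2)) y))"
    using Z unfolding circ_complex_normal_def
    by (intro distributed_joint_indep sigma_finite_lborel) auto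
  moreover have "ennreal (normal_density 0 (sqrt (v / 2)) x) * ennreal (normal_density 0 (sqrt (v / 2)) y)
      = ennreal (exp (- (norm (x, y))\<^sup>2 / v) / (pi * v))" for x y
    using v by (simp add: ennreal_mult'[symmetric] normal_density_def norm_Pair exp_add[symmetric]
        add_divide_distrib diff_divide_distrib)
  ultimately show ?thesis
    by (simp add: lborel_prod case_prod_unfold)
qed

text \<open>The event says that the Gaussian vector lies in a disc centred at \<open>- c\<close>.
  Moving the disc to the origin can only raise its mass, and the centred mass is one minus the
  radial tail.\<close>

lemma (in prob_space) circ_complex_normal_disc_shift_le:
  assumes v: "v > 0" and Z: "circ_complex_normal M v Z" and t: "t \<ge> 0"
  shows "prob {\<omega> \<in> space M. (cmod (Z \<omega> + c))\<^sup>2 < t} \<le> 1 - exp (- (t / v))"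
proof -
  define W where "W = (\<lambda>\<omega>. (Re (Z \<omega>), Im (Z \<omega>)))"
  define f where "f p = ennreal (exp (- (norm p)\<^sup>2 / v) / (pi * v))" for p :: "real \<times> real"
  have W: "distributed M lborel W f"
    using circ_complex_normal_joint_density[OF v Z] by (simp add: W_def f_def[abs_def])
  have [measurable]: "W \<in> borel_measurable M" "f \<in> borel_measurable borel"
    using distributed_measurable[OF W] distributed_borel_measurable[OF W] by simp_all
  define b where "b = (- Re c, - Im c)"
  have "(cmod (Z \<omega> + c))\<^sup>2 < t \<longleftrightarrow> W \<omega> \<in> ball b (sqrt t)" for \<omega>
  proof -
    have "norm (W \<omega> - b) = cmod (Z \<omega> + c)"
      by (simp add: W_def b_def norm_Pair cmod_def)
    moreover have "(cmod (Z \<omega> + c))\<^sup>2 < t \<longleftrightarrow> cmod (Z \<omega> + c) < sqrt t"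
      by (metis norm_ge_zero real_sqrt_abs abs_norm_cancel real_sqrt_less_iff)
    ultimately show ?thesis by (simp add: dist_norm norm_minus_commute)
  qed
  then have "{\<omega> \<in> space M. (cmod (Z \<omega> + c))\<^sup>2 < t} = W -` ball b (sqrt t) \<inter> space M"
    by blast
  then have "emeasure M {\<omega> \<in> space M. (cmod (Z \<omega> + c))\<^sup>2 < t} = emeasure M (W -` ball b (sqrt t) \<inter> space M)"
    by (rule arg_cong)
  also have "\<dots> = (\<integral>\<^sup>+p\<in>ball b (sqrt t). f p \<partial>lborel)"
    by (rule distributed_emeasure[OF W]) simp
  also have "\<dots> \<le> (\<integral>\<^sup>+p\<in>ball 0 (sqrt t). f p \<partial>lborel)"
    using v t by (intro nn_integral_ball_shift_le) (auto simp: f_def intro!: ennreal_leI divide_right_mono power_mono)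
  also have "\<dots> = emeasure M (W -` ball 0 (sqrt t) \<inter> space M)"
    by (rule distributed_emeasure[OF W, symmetric]) simp
  \<comment> \<open>Pass to the complement, because the closed form is known for the mass outside
    the disc.\<close>
  also have "\<dots> = emeasure M (space M - (W -` (- ball 0 (sqrt t)) \<inter> space M))"
    by (intro arg_cong[where f = "emeasure M"]) auto
  also have "\<dots> = 1 - emeasure M (W -` (- ball 0 (sqrt t)) \<inter> space M)"
    by (subst emeasure_compl) (auto simp: emeasure_space_1)
  also have "emeasure M (W -` (- ball 0 (sqrt t)) \<inter> space M) = ennreal (exp (- (t / v)))"
    using nn_integral_radial_exp_tail[OF v, of "sqrt t"] t
    by (subst distributed_emeasure[OF W]) (auto simp: f_def)
  also have "1 - \<dots> = ennreal (1 - exp (- (t / v)))"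
    by (simp add: ennreal_minus flip: ennreal_1)
  finally show ?thesis
    using v t by (simp add: emeasure_eq_measure)
qed

section \<open>Conditioning on one of several independent variables\<close>

text \<open>By independence the joint law is a product measure, so Fubini replaces conditional laws:
  with \<open>X k\<close> frozen at \<open>y\<close>, the constraints cut out a box whose mass
  factorises. The bounds \<open>p i\<close> are uniform in \<open>y\<close>, hence survive
  integration over \<open>y\<close> in \<open>A\<close>.\<close>

lemma (in prob_space) indep_vars_prob_conditioned_le:
  fixes X :: "'i \<Rightarrow> 'a \<Rightarrow> 'b :: second_countable_topology"
  assumes J: "finite J" "k \<notin> J"
    and indep: "indep_vars (\<lambda>_. borel) X (insert k J)"
    and [measurable]: "A \<in> sets borel"
    and C: "\<And>i. i \<in> J \<Longrightarrow> C i \<in> sets (borel \<Otimes>\<^sub>M borel)"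
    and le: "\<And>i y. i \<in> J \<Longrightarrow> prob {\<omega> \<in> space M. (y, X i \<omega>) \<in> C i} \<le> p i"
  shows "prob {\<omega> \<in> space M. X k \<omega> \<in> A \<and> (\<forall>i\<in>J. (X k \<omega>, X i \<omega>) \<in> C i)}
    \<le> prob {\<omega> \<in> space M. X k \<omega> \<in> A} * (\<Prod>i\<in>J. p i)"
proof -
  define I where "I = insert k J"
  have I: "finite I" "I \<noteq> {}" using J by (auto simp: I_def)
  have rv: "random_variable borel (X i)" if "i \<in> I" for i
    using indep that by (auto simp: indep_vars_def I_def)
  \<comment> \<open>Indices outside \<open>I\<close> get the law of \<open>X k\<close> as default,
    so that every \<open>N i\<close> is a probability measure, as
    \<open>product_sigma_finite\<close> demands of the whole family.\<close>
  define N where "N i = distr M borel (X (if i \<in> I then i else k))" for i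
  have N: "N i = distr M borel (X i)" if "i \<in> I" for i
    using that by (simp add: N_def)
  have [measurable_cong, simp]: "sets (N i) = sets borel" for i
    by (simp add: N_def)
  have [simp]: "space (N i) = UNIV" for i
    by (simp add: N_def)
  interpret N: prob_space "N i" for i
    unfolding N_def by (rule prob_space_distr) (auto intro!: rv simp: I_def)
  interpret P: product_sigma_finite N ..
  have pair: "(\<lambda>x. (x k, x i)) \<in> PiM I N \<rightarrow>\<^sub>M borel \<Otimes>\<^sub>M borel" if "i \<in> I" for i
    using that by (intro measurable_Pair) (auto intro!: measurable_component_singleton simp: I_def cong: measurable_cong_sets)
  have PiM_eq: "distr M (PiM I (\<lambda>_. borel)) (\<lambda>\<omega>. \<lambda>i\<in>I. X i \<omega>) = PiM I N"
  proof -
    have "distr M (PiM I (\<lambda>_. borel)) (\<lambda>\<omega>. \<lambda>i\<in>I. X i \<omega>) = PiM I (\<lambda>i. distr M borel (X i))"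
      using indep indep_vars_iff_distr_eq_PiM'[of I X "\<lambda>_. borel"] rv I by (simp add: I_def)
    also have "\<dots> = PiM I N" by (intro PiM_cong) (simp_all add: N)
    finally show ?thesis .
  qed
  define E where "E = {x \<in> space (PiM I N). x k \<in> A \<and> (\<forall>i\<in>J. (x k, x i) \<in> C i)}"
  have E: "E \<in> sets (PiM I N)"
  proof -
    have "{x \<in> space (PiM I N). (x k, x i) \<in> C i} \<in> sets (PiM I N)" if "i \<in> J" for i
      using measurable_sets[OF pair C, of i] that
      by (simp add: I_def vimage_def Int_def conj_commute)
    moreover have "{x \<in> space (PiM I N). x k \<in> A} \<in> sets (PiM I N)"
      by (simp add: I_def)
    ultimately show ?thesis
      unfolding E_def using J by (intro sets.sets_Collect) auto
  qed
  have slice: "{x. (y, x) \<in> C i} \<in> sets borel" if "i \<in> J" for i y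
    using sets_Pair1[OF C[OF that], of y] by (simp add: vimage_def)
  have p: "emeasure (N i) {x. (y, x) \<in> C i} \<le> ennreal (p i)" "0 \<le> p i" if "i \<in> J" for i y
  proof -
    have "emeasure (N i) {x. (y, x) \<in> C i} = emeasure M {\<omega> \<in> space M. (y, X i \<omega>) \<in> C i}"
      using that rv slice by (subst N) (auto simp: I_def emeasure_distr vimage_def Int_def conj_commute)
    also have "\<dots> \<le> ennreal (p i)"
      using le[OF that] by (simp add: emeasure_eq_measure ennreal_leI)
    finally show "emeasure (N i) {x. (y, x) \<in> C i} \<le> ennreal (p i)" .
    show "0 \<le> p i" using le[OF that] measure_nonneg order.trans by blast
  qed
  \<comment> \<open>Once coordinate \<open>k\<close> equals \<open>y\<close>, each remaining
    constraint involves a single coordinate: the section of \<open>E\<close> is a box if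
    \<open>y\<close> lies in \<open>A\<close>, and empty otherwise.\<close>
  have inner: "(\<integral>\<^sup>+x. indicator E (x(k := y)) \<partial>PiM J N) \<le> indicator A y * ennreal (\<Prod>i\<in>J. p i)" for y
  proof -
    have "(\<integral>\<^sup>+x. indicator E (x(k := y)) \<partial>PiM J N)
        = (\<integral>\<^sup>+x. indicator A y * indicator (\<Pi>\<^sub>E i\<in>J. {x. (y, x) \<in> C i}) x \<partial>PiM J N)"
      using J by (intro nn_integral_cong)
        (auto simp: E_def I_def indicator_def space_PiM PiE_iff extensional_def split: if_splits)
    also have "\<dots> = indicator A y * emeasure (PiM J N) (\<Pi>\<^sub>E i\<in>J. {x. (y, x) \<in> C i})"
      using J slice by (subst nn_integral_cmult_indicator) (auto intro!: sets_PiM_I_finite)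
    also have "emeasure (PiM J N) (\<Pi>\<^sub>E i\<in>J. {x. (y, x) \<in> C i}) = (\<Prod>i\<in>J. emeasure (N i) {x. (y, x) \<in> C i})"
      using J slice by (intro P.emeasure_PiM) auto
    also have "\<dots> \<le> (\<Prod>i\<in>J. ennreal (p i))"
      using p(1) by (intro prod_mono_ennreal) auto
    also have "\<dots> = ennreal (\<Prod>i\<in>J. p i)"
      using p by (intro prod_ennreal) auto
    finally show ?thesis by (simp add: mult_left_mono del: fun_upd_apply)
  qed
  have "emeasure M {\<omega> \<in> space M. X k \<omega> \<in> A \<and> (\<forall>i\<in>J. (X k \<omega>, X i \<omega>) \<in> C i)}
      = emeasure M ((\<lambda>\<omega>. \<lambda>i\<in>I. X i \<omega>) -` E \<inter> space M)"
    by (intro arg_cong[where f = "emeasure M"]) (auto simp: E_def I_def space_PiM)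
  also have "\<dots> = emeasure (PiM I N) E"
    unfolding PiM_eq[symmetric] using E rv
    by (subst emeasure_distr) (auto intro!: measurable_restrict simp: sets_PiM_cong[of I I N "\<lambda>_. borel"])
  also have "\<dots> = (\<integral>\<^sup>+x. indicator E x \<partial>PiM I N)"
    using E by simp
  \<comment> \<open>Fubini with coordinate \<open>k\<close> outermost, which plays the part of
    conditioning on \<open>X k\<close>.\<close>
  also have "\<dots> = (\<integral>\<^sup>+y. \<integral>\<^sup>+x. indicator E (x(k := y)) \<partial>PiM J N \<partial>N k)"
    unfolding I_def using J E by (intro P.product_nn_integral_insert_rev) (auto simp: I_def)
  also have "\<dots> \<le> (\<integral>\<^sup>+y. indicator A y * ennreal (\<Prod>i\<in>J. p i) \<partial>N k)"
    by (intro nn_integral_mono inner)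
  also have "\<dots> = emeasure (N k) A * ennreal (\<Prod>i\<in>J. p i)"
    by (subst nn_integral_multc) auto
  also have "emeasure (N k) A = emeasure M {\<omega> \<in> space M. X k \<omega> \<in> A}"
    using rv by (subst N) (auto simp: I_def emeasure_distr vimage_def Int_def conj_commute)
  finally show ?thesis
    using p(2) by (simp add: emeasure_eq_measure prod_nonneg flip: ennreal_mult')
qed

section \<open>From the outage event to the product bound over the ports\<close>

lemma fas_amplitude_less_imp:
  assumes "(fas_amplitude MR MT h \<omega>)\<^sup>2 < \<gamma>" "i \<in> {1..MR}" "j \<in> {1..MT}"
  shows "(cmod (h i j \<omega>))\<^sup>2 < \<gamma>"
proof -
  \<comment> \<open>Writing the set as the image of a finite grid supplies the finiteness for
    \<open>Max_ge\<close>.\<close>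
  have "{cmod (h i j \<omega>) | i j. i \<in> {1..MR} \<and> j \<in> {1..MT}} = (\<lambda>(i, j). cmod (h i j \<omega>)) ` ({1..MR} \<times> {1..MT})"
    by (auto simp: image_iff) blast
  then have "cmod (h i j \<omega>) \<le> fas_amplitude MR MT h \<omega>"
    using assms(2,3) unfolding fas_amplitude_def by (intro Max_ge) auto
  then have "(cmod (h i j \<omega>))\<^sup>2 \<le> (fas_amplitude MR MT h \<omega>)\<^sup>2"
    by (intro power_mono) auto
  then show ?thesis using assms(1) by simp
qed

theorem corollary4:
  fixes M :: "'a measure"
    and MR MT :: nat
    and \<rho>1 \<rho>2 \<gamma> :: real
    and z :: "nat \<Rightarrow> nat \<Rightarrow> 'a \<Rightarrow> complex"
  assumes "prob_space M"
    and "MR \<ge> 1" and "MT \<ge> 1"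
    and "\<bar>\<rho>1\<bar> < 1" and "\<bar>\<rho>2\<bar> < 1"
    and "prob_space.indep_vars M (\<lambda>_. borel) (\<lambda>(i, j). z i j) ({1..MR} \<times> {1..MT})"
    and "\<And>i j. i \<in> {1..MR} \<Longrightarrow> j \<in> {1..MT} \<Longrightarrow> circ_complex_normal M 1 (z i j)"
    and "\<gamma> > 0"
  shows "outage_prob M MR MT (channel \<rho>1 \<rho>2 z) \<gamma>
    \<le> (1 - exp (- \<gamma>))
      * (1 - exp (- (\<gamma> / (1 - \<rho>1\<^sup>2)))) ^ (MR - 1)
      * (1 - exp (- (\<gamma> / (1 - \<rho>2\<^sup>2)))) ^ (MT - 1)
      * (1 - exp (- (\<gamma> / (1 - \<rho>1\<^sup>2 * \<rho>2\<^sup>2)))) ^ ((MR - 1) * (MT - 1))"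
proof -
  interpret prob_space M by fact
  note CN = assms(7) and \<gamma> = assms(8)
  define I where "I = {1..MR} \<times> {1..MT}"
  define J where "J = I - {(1, 1)}"
  have I: "I = insert (1, 1) J" and J: "finite J" "(1, 1) \<notin> J"
    using assms(2,3) by (auto simp: I_def J_def)
  define X where "X = (\<lambda>(i, j). z i j)"
  \<comment> \<open>Correlation of port \<open>q\<close> with the shared variable: one formula
    \<open>h\<close> then covers all three kinds of port in \<open>J\<close>. The corner
    \<open>(1, 1)\<close>, where \<open>r\<close> is 1 and \<open>1 - (r q)\<^sup>2\<close>
    vanishes, is handled through \<open>A\<close>.\<close>
  define r where "r = (\<lambda>(i, j). (if i = (1::nat) then 1 else \<rho>1) * (if j = (1::nat) then 1 else \<rho>2))"
  define h where "h q y w = of_real (sqrt (1 - (r q)\<^sup>2)) * w + of_real (r q) * y"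
    for q and y w :: complex
  define C where "C q = {(y, w). (cmod (h q y w))\<^sup>2 < \<gamma>}" for q
  define A where "A = {y :: complex. (cmod y)\<^sup>2 < \<gamma>}"
  define p where "p q = 1 - exp (- (\<gamma> / (1 - (r q)\<^sup>2)))" for q
  have \<rho>: "\<rho>1\<^sup>2 < 1" "\<rho>2\<^sup>2 < 1" using assms(4,5) by (simp_all add: abs_square_less_1)
  then have "\<rho>1\<^sup>2 * \<rho>2\<^sup>2 < 1"
    by (meson less_eq_real_def mult_le_one order_le_less_trans mult_left_le zero_le_power2)
  then have r: "(r q)\<^sup>2 < 1" if "q \<in> J" for q
    using that \<rho> by (cases q) (auto simp: r_def J_def power_mult_distrib)
  have channel: "channel \<rho>1 \<rho>2 z i j \<omega> = h (i, j) (X (1, 1) \<omega>) (X (i, j) \<omega>)" if "(i, j) \<in> J" for i j \<omega>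
    using that by (auto simp: channel_def h_def X_def r_def J_def power_mult_distrib)
  have indep: "indep_vars (\<lambda>_. borel) X (insert (1, 1) J)"
    using assms(6) by (simp only: X_def I[symmetric] I_def)
  have rv: "random_variable borel (X q)" if "q \<in> I" for q
    using indep that by (auto simp: indep_vars_def I)
  have C: "C q \<in> sets (borel \<Otimes>\<^sub>M borel)" for q
  proof -
    have "open {x. (cmod (h q (fst x) (snd x)))\<^sup>2 < \<gamma>}"
      unfolding h_def by (intro open_Collect_less continuous_intros)
    then show ?thesis
      unfolding C_def case_prod_unfold borel_prod by (rule borel_open)
  qed
  have A: "A \<in> sets borel"
    unfolding A_def by measurable
  have le: "prob {\<omega> \<in> space M. (y, X q \<omega>) \<in> C q} \<le> p q" if q: "q \<in> J" for q y
  proof -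
    obtain i j where ij: "q = (i, j)" "i \<in> {1..MR}" "j \<in> {1..MT}"
      using q by (auto simp: J_def I_def)
    define s where "s = sqrt (1 - (r q)\<^sup>2)"
    have s: "s > 0" "s\<^sup>2 = 1 - (r q)\<^sup>2" using r[OF q] by (simp_all add: s_def)
    \<comment> \<open>Factoring out \<open>s\<close> leaves a shifted variable of variance 1, so the
      threshold becomes \<open>\<gamma> / s\<^sup>2\<close>; this produces the denominators
      \<open>1 - (r q)\<^sup>2\<close> in the bound.\<close>
    have "h q y w = of_real s * (w + of_real (r q) * y / of_real s)" for w
      using s(1) by (simp add: h_def s_def[symmetric] algebra_simps)
    then have "(y, w) \<in> C q \<longleftrightarrow> (cmod (w + of_real (r q) * y / of_real s))\<^sup>2 < \<gamma> / s\<^sup>2" for w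
      using s(1) by (simp add: C_def norm_mult power_mult_distrib pos_less_divide_eq mult.commute)
    moreover have "\<gamma> / s\<^sup>2 \<ge> 0" using \<gamma> by simp
    ultimately show ?thesis
      using circ_complex_normal_disc_shift_le[OF _ CN[OF ij(2,3)], of "\<gamma> / s\<^sup>2" "of_real (r q) * y / of_real s"]
      by (simp add: X_def ij(1) p_def s(2))
  qed
  have "outage_prob M MR MT (channel \<rho>1 \<rho>2 z) \<gamma>
      \<le> prob {\<omega> \<in> space M. X (1, 1) \<omega> \<in> A \<and> (\<forall>q\<in>J. (X (1, 1) \<omega>, X q \<omega>) \<in> C q)}"
    unfolding outage_prob_def
  \<comment> \<open>Monotonicity asks for measurability of the larger event, which the second half
    of this block establishes.\<close>
  proof (rule finite_measure_mono)
    show "{\<omega> \<in> space M. (fas_amplitude MR MT (channel \<rho>1 \<rho>2 z) \<omega>)\<^sup>2 < \<gamma>}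
        \<subseteq> {\<omega> \<in> space M. X (1, 1) \<omega> \<in> A \<and> (\<forall>q\<in>J. (X (1, 1) \<omega>, X q \<omega>) \<in> C q)}"
    proof safe
      fix \<omega> assume "(fas_amplitude MR MT (channel \<rho>1 \<rho>2 z) \<omega>)\<^sup>2 < \<gamma>"
      note less = fas_amplitude_less_imp[OF this]
      show "X (1, 1) \<omega> \<in> A"
        using less[of 1 1] assms(2,3) by (simp add: channel_def A_def X_def)
      fix i j assume ij: "(i, j) \<in> J"
      then show "(X (1, 1) \<omega>, X (i, j) \<omega>) \<in> C (i, j)"
        using less[of i j] channel[OF ij] by (simp add: C_def J_def I_def)
    qed
    have "{\<omega> \<in> space M. (X (1, 1) \<omega>, X q \<omega>) \<in> C q} \<in> events" if "q \<in> J" for q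
      using measurable_sets[OF measurable_Pair[OF rv rv] C, of "(1, 1)" q q] that
      by (simp add: I vimage_def Int_def conj_commute)
    moreover have "{\<omega> \<in> space M. X (1, 1) \<omega> \<in> A} \<in> events"
      using measurable_sets[OF rv A, of "(1, 1)"] by (simp add: I vimage_def Int_def conj_commute)
    ultimately show "{\<omega> \<in> space M. X (1, 1) \<omega> \<in> A \<and> (\<forall>q\<in>J. (X (1, 1) \<omega>, X q \<omega>) \<in> C q)} \<in> events"
      using J by (intro sets.sets_Collect) auto
  qed
  also have "\<dots> \<le> prob {\<omega> \<in> space M. X (1, 1) \<omega> \<in> A} * prod p J"
    by (rule indep_vars_prob_conditioned_le[OF J indep A C le])
  also have "\<dots> \<le> (1 - exp (- \<gamma>)) * prod p J"
  proof (rule mult_right_mono)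
    \<comment> \<open>The corner port is the case of variance 1 and shift 0.\<close>
    show "prob {\<omega> \<in> space M. X (1, 1) \<omega> \<in> A} \<le> 1 - exp (- \<gamma>)"
      using circ_complex_normal_disc_shift_le[OF _ CN[of 1 1], of \<gamma> 0] assms(2,3) \<gamma>
      by (simp add: X_def A_def)
    show "0 \<le> prod p J"
      using r \<gamma> by (intro prod_nonneg) (auto simp: p_def less_imp_le)
  qed
  also have "prod p J = (1 - exp (- (\<gamma> / (1 - \<rho>1\<^sup>2)))) ^ (MR - 1)
      * (1 - exp (- (\<gamma> / (1 - \<rho>2\<^sup>2)))) ^ (MT - 1)
      * (1 - exp (- (\<gamma> / (1 - \<rho>1\<^sup>2 * \<rho>2\<^sup>2)))) ^ ((MR - 1) * (MT - 1))"
  proof -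
    \<comment> \<open>Split by the value of \<open>r\<close>: it is \<open>\<rho>1\<close> on the
      first block, \<open>\<rho>2\<close> on the second and their product on the third, so
      \<open>p\<close> is constant on each and the exponents are cardinalities. For
      \<open>MR = 1\<close> or \<open>MT = 1\<close> the corresponding ranges are empty and the
      exponents 0.\<close>
    have "J = ({2..MR} \<times> {1} \<union> {1} \<times> {2..MT}) \<union> {2..MR} \<times> {2..MT}"
      using assms(2,3) by (auto simp: J_def I_def)
    moreover have "prod p (({2..MR} \<times> {1} \<union> {1} \<times> {2..MT}) \<union> {2..MR} \<times> {2..MT})
        = prod p ({2..MR} \<times> {1} \<union> {1} \<times> {2..MT}) * prod p ({2..MR} \<times> {2..MT})"
      by (rule prod.union_disjoint) auto
    moreover have "prod p ({2..MR} \<times> {1} \<union> {1} \<times> {2..MT})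
        = prod p ({2..MR} \<times> {1}) * prod p ({1} \<times> {2..MT})"
      by (rule prod.union_disjoint) auto
    moreover have "prod p ({2..MR} \<times> {1}) = (\<Prod>q\<in>{2..MR} \<times> {1::nat}. 1 - exp (- (\<gamma> / (1 - \<rho>1\<^sup>2))))"
      by (intro prod.cong) (auto simp: p_def r_def)
    moreover have "prod p ({1} \<times> {2..MT}) = (\<Prod>q\<in>{1::nat} \<times> {2..MT}. 1 - exp (- (\<gamma> / (1 - \<rho>2\<^sup>2))))"
      by (intro prod.cong) (auto simp: p_def r_def)
    moreover have "prod p ({2..MR} \<times> {2..MT})
        = (\<Prod>q\<in>{2..MR} \<times> {2..MT}. 1 - exp (- (\<gamma> / (1 - \<rho>1\<^sup>2 * \<rho>2\<^sup>2))))"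
      by (intro prod.cong) (auto simp: p_def r_def power_mult_distrib)
    ultimately show ?thesis
      by (simp only: prod_constant card_cartesian_product card_atLeastAtMost) (simp add: numeral_2_eq_2)
  qed
  finally show ?thesis by (simp only: mult.assoc)
qed

end
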